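(* There exist absolute constants $c_1,c_2,c_3>0$ such that the following holds for every $n$, every undirected graph $\mathbb{G}$ on $[n]$ without self-loops, with maximal independent set $\mathcal{S}$ of size $m$, and every $\epsilon\in[0,1]$, with $\mathcal{MC}(C^\epsilon,u^* )$ the associated instance defined in the context: (i) if $\epsilon\ge c_1/m$ (that is, $\epsilon\ge\Theta(m^{-1})$), then the instance $\mathcal{MC}(C^\epsilon,u^* )$ does not have spurious second-order critical points, namely, all second-order critical points are global minima associated with the ground truth solution $M^*=u^*(u^* )^T$; (ii) if $\epsilon\le c_2/m$ (that is, $\epsilon=O(m^{-1})$), then the instance $\mathcal{MC}(C^\epsilon,u^* )$ has at least $c_3\,2^{m/2}$ (that is, at least $O(2^{m/2})$) spurious local minima.
   Context: For a symmetric nonnegative matrix $C\in\mathbb{R}^{n\times n}$ and $u^*\in\mathbb{R}^n$, the instance $\mathcal{MC}(C,u^* )$ is the problem of minimizing $g(u;C,u^* )=\sum_{i,j\in[n]}C_{ij}(u_iu_j-u_i^*u_j^* )^2$ over $u\in\mathbb{R}^n$. A second-order critical point is a point $u$ satisfying the first- and second-order necessary optimality conditions, $\nabla g(u;C,u^* )=0$ and $\nabla^2g(u;C,u^* )\succeq0$; it is spurious if $uu^T\ne u^*(u^* )^T$. A spurious local minimum is a local minimum $u$ of $g(\cdot;C,u^* )$ with $uu^T\neq u^*(u^* )^T$. The instance $\mathcal{MC}(C^\epsilon,u^* )$: let $\mathbb{G}=([n],\mathbb{E})$ be an unweighted undirected graph without self-loops, and $\mathcal{S}\subset[n]$ a maximal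 independent set, meaning an independent set with the maximum number of nodes; $m:=|\mathcal{S}|$. Put $Z_\epsilon:=2|\mathbb{E}|+n+m(m-1)\epsilon$ and $C^\epsilon_{ij}:=\epsilon/Z_\epsilon$ for $i,j\in\mathcal{S}$, $i\ne j$; $C^\epsilon_{ij}:=1/Z_\epsilon$ if $\{i,j\}\in\mathbb{E}$; $C^\epsilon_{ii}:=1/Z_\epsilon$ for $i\in[n]$; $C^\epsilon_{ij}:=0$ otherwise; $u_i^*:=1/m$ for $i\in\mathcal{S}$ and $u_i^*:=0$ for $i\notin\mathcal{S}$.
   Formalization: Part (ii) is stated for m ≥ 2 only: when m = 1 there are no spurious local minima (e.g. n = 1, ε = 0, g(u) = (u²−1)², minima ±1), so the bound c_3·2^{m/2} > 0 fails for every choice of constants. *)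

theory Defs
  imports "HOL-Analysis.Analysis" "Jordan_Normal_Form.Matrix"
begin

no_notation vec_nth (infixl "$" 90)
no_notation inner (infix "\<bullet>" 70)

text \<open>
  The dimension \<open>n\<close> is quantified inside the scope of the absolute constants, so it cannot be a
  type: points of \<open>\<real>\<^sup>n\<close> are the elements of \<open>carrier_vec n\<close>, and the index set \<open>[n]\<close> is \<open>{..<n}\<close>.
\<close>


section \<open>Optimality conditions\<close>

definition outer :: "real Matrix.vec \<Rightarrow> real Matrix.mat" where
  "outer u = Matrix.mat (dim_vec u) (dim_vec u) (\<lambda>(i, j). u $ i * u $ j)"

definition partial :: "nat \<Rightarrow> (real Matrix.vec \<Rightarrow> real) \<Rightarrow> real Matrix.vec \<Rightarrow> real" where
  "partial i f u = deriv (\<lambda>t. f (u + t \<cdot>\<^sub>v unit_vec (dim_vec u) i)) 0"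

definition gradient :: "(real Matrix.vec \<Rightarrow> real) \<Rightarrow> real Matrix.vec \<Rightarrow> real Matrix.vec" where
  "gradient f u = Matrix.vec (dim_vec u) (\<lambda>i. partial i f u)"

definition hessian :: "(real Matrix.vec \<Rightarrow> real) \<Rightarrow> real Matrix.vec \<Rightarrow> real Matrix.mat" where
  "hessian f u = Matrix.mat (dim_vec u) (dim_vec u) (\<lambda>(i, j). partial i (partial j f) u)"

definition pos_semidef :: "real Matrix.mat \<Rightarrow> bool" where
  "pos_semidef A \<longleftrightarrow> (\<forall>x \<in> carrier_vec (dim_row A). 0 \<le> x \<bullet> (A *\<^sub>v x))"

definition second_order_critical :: "nat \<Rightarrow> (real Matrix.vec \<Rightarrow> real) \<Rightarrow> real Matrix.vec \<Rightarrow> bool" where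
  "second_order_critical n f u \<longleftrightarrow>
     u \<in> carrier_vec n \<and> gradient f u = 0\<^sub>v n \<and> pos_semidef (hessian f u)"

definition local_minimum :: "nat \<Rightarrow> (real Matrix.vec \<Rightarrow> real) \<Rightarrow> real Matrix.vec \<Rightarrow> bool" where
  "local_minimum n f u \<longleftrightarrow> u \<in> carrier_vec n \<and>
     (\<exists>\<delta>>0. \<forall>v \<in> carrier_vec n. sqrt ((v - u) \<bullet> (v - u)) < \<delta> \<longrightarrow> f u \<le> f v)"

definition global_minimum :: "nat \<Rightarrow> (real Matrix.vec \<Rightarrow> real) \<Rightarrow> real Matrix.vec \<Rightarrow> bool" where
  "global_minimum n f u \<longleftrightarrow> u \<in> carrier_vec n \<and> (\<forall>v \<in> carrier_vec n. f u \<le> f v)"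


section \<open>The problem \<open>\<M>\<C>(C, u\<^sup>*)\<close>\<close>

definition mc_obj :: "real Matrix.mat \<Rightarrow> real Matrix.vec \<Rightarrow> real Matrix.vec \<Rightarrow> real" where
  "mc_obj C us u =
     (\<Sum>i<dim_vec us. \<Sum>j<dim_vec us. C $$ (i, j) * (u $ i * u $ j - us $ i * us $ j)\<^sup>2)"

definition spurious_second_order_critical ::
    "real Matrix.mat \<Rightarrow> real Matrix.vec \<Rightarrow> real Matrix.vec \<Rightarrow> bool" where
  "spurious_second_order_critical C us u \<longleftrightarrow>
     second_order_critical (dim_vec us) (mc_obj C us) u \<and> outer u \<noteq> outer us"

definition spurious_local_minimum ::
    "real Matrix.mat \<Rightarrow> real Matrix.vec \<Rightarrow> real Matrix.vec \<Rightarrow> bool" where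
  "spurious_local_minimum C us u \<longleftrightarrow>
     local_minimum (dim_vec us) (mc_obj C us) u \<and> outer u \<noteq> outer us"


section \<open>The instance attached to a graph\<close>

definition simple_graph :: "nat \<Rightarrow> nat set set \<Rightarrow> bool" where
  "simple_graph n E \<longleftrightarrow> (\<forall>e \<in> E. e \<subseteq> {..<n} \<and> card e = 2)"

definition independent_set :: "nat \<Rightarrow> nat set set \<Rightarrow> nat set \<Rightarrow> bool" where
  "independent_set n E S \<longleftrightarrow> S \<subseteq> {..<n} \<and> (\<forall>i \<in> S. \<forall>j \<in> S. {i, j} \<notin> E)"

text \<open>Maximal with respect to cardinality, not just inclusion.\<close>

definition maximal_independent_set :: "nat \<Rightarrow> nat set set \<Rightarrow> nat set \<Rightarrow> bool" where
  "maximal_independent_set n E S \<longleftrightarrow>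
     independent_set n E S \<and> (\<forall>T. independent_set n E T \<longrightarrow> card T \<le> card S)"

definition Z_eps :: "nat \<Rightarrow> nat set set \<Rightarrow> nat set \<Rightarrow> real \<Rightarrow> real" where
  "Z_eps n E S \<epsilon> = 2 * real (card E) + real n + real (card S) * (real (card S) - 1) * \<epsilon>"

definition C_eps :: "nat \<Rightarrow> nat set set \<Rightarrow> nat set \<Rightarrow> real \<Rightarrow> real Matrix.mat" where
  "C_eps n E S \<epsilon> = Matrix.mat n n (\<lambda>(i, j).
     if i \<in> S \<and> j \<in> S \<and> i \<noteq> j then \<epsilon> / Z_eps n E S \<epsilon>
     else if {i, j} \<in> E then 1 / Z_eps n E S \<epsilon>
     else if i = j then 1 / Z_eps n E S \<epsilon>
     else 0)"

definition u_star :: "nat \<Rightarrow> nat set \<Rightarrow> real Matrix.vec" where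
  "u_star n S = Matrix.vec n (\<lambda>i. if i \<in> S then 1 / real (card S) else 0)"

end

theory Submission
  imports Defs
begin

text \<open>
  Rescale to \<open>x = m u\<close>. A critical point vanishes off \<open>S\<close>, because there the gradient is \<open>x\<^sub>k\<close> times a
  sum of nonnegative terms; so the problem reduces to the coordinates in \<open>S\<close>, where the graph has
  no edges. For \<open>\<epsilon> \<ge> 3/m\<close>, positive curvature along the all-ones vector forces \<open>x\<close> to be constant on \<open>S\<close>.
  For \<open>\<epsilon> \<le> 1/(25 m)\<close> the coupling is too weak to change signs: every non-constant sign pattern on \<open>S\<close>
  carries its own local minimum.
\<close>

section \<open>First and second derivatives of the objective\<close>

text \<open>Writing the shift as \<open>t * of_bool (i = k)\<close> keeps every coordinate affine in
  \<open>t\<close>, so the derivative rules apply without a case split.\<close>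

lemma index_shift_unit_vec:
  fixes u :: "real Matrix.vec"
  assumes "u \<in> carrier_vec n" "i < n" "k < n"
  shows "(u + t \<cdot>\<^sub>v unit_vec (dim_vec u) k) $ i = u $ i + t * of_bool (i = k)"
  using assms by (auto simp: unit_vec_def)

lemma partial_mc_obj:
  fixes u us :: "real Matrix.vec"
  assumes u: "u \<in> carrier_vec n" and us: "dim_vec us = n" and k: "k < n"
    and sym: "\<forall>i<n. \<forall>j<n. C $$ (i, j) = C $$ (j, i)"
  shows "partial k (mc_obj C us) u
    = 4 * (\<Sum>j<n. C $$ (k, j) * (u $ k * u $ j - us $ k * us $ j) * u $ j)"
proof -
  define w where "w = (\<lambda>i j. C $$ (i, j) * (u $ i * u $ j - us $ i * us $ j))"
  have wsym: "w i j = w j i" if "i < n" "j < n" for i j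
    using sym that by (simp add: w_def mult.commute)
  have eq: "(\<lambda>t. mc_obj C us (u + t \<cdot>\<^sub>v unit_vec (dim_vec u) k)) =
     (\<lambda>t. \<Sum>i<n. \<Sum>j<n. C $$ (i, j) *
       ((u $ i + t * of_bool (i = k)) * (u $ j + t * of_bool (j = k)) - us $ i * us $ j)\<^sup>2)"
    unfolding mc_obj_def us
    by (intro ext sum.cong refl) (simp only: index_shift_unit_vec[OF u _ k] lessThan_iff)
  \<comment> \<open>Coordinate \<open>k\<close> enters once through its row and once through its
    column. Symmetry of \<open>C\<close> makes the two contributions equal, which turns the factor 2
    of the square into 4.\<close>
  have "((\<lambda>t. mc_obj C us (u + t \<cdot>\<^sub>v unit_vec (dim_vec u) k)) has_real_derivative
      (\<Sum>i<n. \<Sum>j<n. 2 * w i j * (of_bool (i = k) * u $ j + u $ i * of_bool (j = k)))) (at 0)"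
    unfolding eq w_def
    by (auto intro!: derivative_eq_intros sum.cong simp: algebra_simps)
  then have "partial k (mc_obj C us) u =
      (\<Sum>i<n. \<Sum>j<n. 2 * w i j * (of_bool (i = k) * u $ j + u $ i * of_bool (j = k)))"
    unfolding partial_def by (rule DERIV_imp_deriv)
  also have "\<dots> = (\<Sum>i<n. of_bool (i = k) * (\<Sum>j<n. 2 * w i j * u $ j))
      + (\<Sum>i<n. \<Sum>j<n. of_bool (j = k) * (2 * w i j * u $ i))"
    by (simp add: sum.distrib[symmetric] sum_distrib_left algebra_simps)
  also have "(\<Sum>i<n. of_bool (i = k) * (\<Sum>j<n. 2 * w i j * u $ j)) = (\<Sum>j<n. 2 * w k j * u $ j)"
    using k by (simp add: of_bool_def if_distrib[of "\<lambda>x. x * _"] cong: if_cong)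
  also have "(\<Sum>i<n. \<Sum>j<n. of_bool (j = k) * (2 * w i j * u $ i)) = (\<Sum>i<n. 2 * w k i * u $ i)"
    using k wsym by (simp add: of_bool_def if_distrib[of "\<lambda>x. x * _"] cong: if_cong)
  finally show ?thesis
    by (simp add: w_def sum_distrib_left sum.distrib[symmetric] algebra_simps)
qed

lemma partial_partial_mc_obj:
  fixes u us :: "real Matrix.vec"
  assumes u: "u \<in> carrier_vec n" and us: "dim_vec us = n" and k: "k < n" and l: "l < n"
    and sym: "\<forall>i<n. \<forall>j<n. C $$ (i, j) = C $$ (j, i)"
  shows "partial l (partial k (mc_obj C us)) u
    = 4 * (of_bool (l = k) * (\<Sum>j<n. C $$ (k, j) * (u $ j)\<^sup>2)
        + C $$ (k, l) * (2 * u $ k * u $ l - us $ k * us $ l))"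
proof -
  \<comment> \<open>The closed form of the first derivative is needed along the whole line through
    \<open>u\<close>, not only at \<open>u\<close>, before it can be differentiated again.\<close>
  have eq: "(\<lambda>t. partial k (mc_obj C us) (u + t \<cdot>\<^sub>v unit_vec (dim_vec u) l)) =
     (\<lambda>t. 4 * (\<Sum>j<n. C $$ (k, j) * ((u $ k + t * of_bool (k = l)) * (u $ j + t * of_bool (j = l))
         - us $ k * us $ j) * (u $ j + t * of_bool (j = l))))"
  proof
    fix t
    have "u + t \<cdot>\<^sub>v unit_vec (dim_vec u) l \<in> carrier_vec n"
      using u by auto
    note * = partial_mc_obj[OF this us k sym]
    show "partial k (mc_obj C us) (u + t \<cdot>\<^sub>v unit_vec (dim_vec u) l) =
      4 * (\<Sum>j<n. C $$ (k, j) * ((u $ k + t * of_bool (k = l)) * (u $ j + t * of_bool (j = l))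
         - us $ k * us $ j) * (u $ j + t * of_bool (j = l)))"
      unfolding * by (intro arg_cong[where f = "\<lambda>x. 4 * x"] sum.cong refl)
        (simp only: index_shift_unit_vec[OF u _ l] lessThan_iff k)
  qed
  have "((\<lambda>t. partial k (mc_obj C us) (u + t \<cdot>\<^sub>v unit_vec (dim_vec u) l)) has_real_derivative
      4 * (\<Sum>j<n. of_bool (l = k) * (C $$ (k, j) * (u $ j)\<^sup>2)
        + of_bool (j = l) * (C $$ (k, j) * (2 * u $ k * u $ j - us $ k * us $ j)))) (at 0)"
    unfolding eq
    by (auto intro!: derivative_eq_intros sum.cong simp: algebra_simps power2_eq_square)
  then have "partial l (partial k (mc_obj C us)) u =
      4 * (\<Sum>j<n. of_bool (l = k) * (C $$ (k, j) * (u $ j)\<^sup>2)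
        + of_bool (j = l) * (C $$ (k, j) * (2 * u $ k * u $ j - us $ k * us $ j)))"
    unfolding partial_def[of l] by (rule DERIV_imp_deriv)
  also have "\<dots> = 4 * (of_bool (l = k) * (\<Sum>j<n. C $$ (k, j) * (u $ j)\<^sup>2)
        + (\<Sum>j<n. of_bool (j = l) * (C $$ (k, j) * (2 * u $ k * u $ j - us $ k * us $ j))))"
    by (simp add: sum.distrib sum_distrib_left)
  also have "(\<Sum>j<n. of_bool (j = l) * (C $$ (k, j) * (2 * u $ k * u $ j - us $ k * us $ j)))
      = C $$ (k, l) * (2 * u $ k * u $ l - us $ k * us $ l)"
    using l by (simp add: of_bool_def if_distrib[of "\<lambda>x. x * _"] cong: if_cong)
  finally show ?thesis .
qed

lemma scalar_prod_mult_mat_vec: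
  fixes A :: "real Matrix.mat"
  assumes "A \<in> carrier_mat n n" "x \<in> carrier_vec n"
  shows "x \<bullet> (A *\<^sub>v x) = (\<Sum>i<n. \<Sum>j<n. x $ i * A $$ (i, j) * x $ j)"
  using assms
  by (auto simp: scalar_prod_def sum_distrib_left lessThan_atLeast0 algebra_simps intro!: sum.cong)

section \<open>The instance on the independent set\<close>

text \<open>The entries of \<open>C_eps\<close> on \<open>S\<close>, multiplied by
  \<open>Z_eps\<close>.\<close>

definition coupling :: "real \<Rightarrow> nat \<Rightarrow> nat \<Rightarrow> real" where
  "coupling \<epsilon> i j = (if i = j then 1 else \<epsilon>)"

text \<open>The coupling matrix is \<epsilon> times the all-ones matrix plus
  \<open>1 - \<epsilon>\<close> times the identity.\<close>

lemma sum_coupling: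
  assumes "finite S" "k \<in> S"
  shows "(\<Sum>j\<in>S. coupling \<epsilon> k j * f j) = \<epsilon> * (\<Sum>j\<in>S. f j) + (1 - \<epsilon>) * f k"
proof -
  have "(\<Sum>j\<in>S. coupling \<epsilon> k j * f j) = f k + \<epsilon> * (\<Sum>j\<in>S - {k}. f j)"
    using assms by (subst sum.remove[of S k]) (auto simp: coupling_def sum_distrib_left intro!: sum.cong)
  moreover have "(\<Sum>j\<in>S. f j) = f k + (\<Sum>j\<in>S - {k}. f j)"
    using assms by (rule sum.remove)
  ultimately show ?thesis by (simp add: algebra_simps)
qed

text \<open>All coordinates are roots of one cubic with coefficients depending only on \<open>\<Sum>x\<^sub>j\<close> and
  \<open>\<Sum>x\<^sub>j\<^sup>2\<close>. Positive curvature in the direction of the all-ones vector makes \<open>\<Sum>x\<^sub>j\<^sup>2\<close> large enough for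
  that cubic to be strictly increasing.\<close>

lemma critical_on_independent_set:
  fixes x :: "nat \<Rightarrow> real"
  assumes fin: "finite S" and eps: "0 \<le> \<epsilon>" "\<epsilon> \<le> 1" and large: "3 \<le> \<epsilon> * real (card S)"
    and grad: "\<And>k. k \<in> S \<Longrightarrow> (\<Sum>j\<in>S. coupling \<epsilon> k j * ((x k * x j - 1) * x j)) = 0"
    and curv: "0 \<le> (\<Sum>k\<in>S. \<Sum>j\<in>S. coupling \<epsilon> k j * (x j)\<^sup>2)
       + (\<Sum>k\<in>S. \<Sum>j\<in>S. coupling \<epsilon> k j * (2 * x k * x j - 1))"
  shows "(\<forall>k\<in>S. x k = 1) \<or> (\<forall>k\<in>S. x k = -1)"
proof -
  define m where "m = real (card S)"
  define P where "P = (\<Sum>j\<in>S. (x j)\<^sup>2)"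
  define T where "T = (\<Sum>j\<in>S. x j)"
  have epos: "\<epsilon> > 0" and mpos: "m > 0"
    using large eps by (auto simp: m_def intro: ccontr)
  have cubic: "(1 - \<epsilon>) * x k ^ 3 + (\<epsilon> * P - (1 - \<epsilon>)) * x k = \<epsilon> * T" if "k \<in> S" for k
  proof -
    have "(\<Sum>j\<in>S. (x k * x j - 1) * x j) = x k * P - T"
      by (simp add: P_def T_def sum_distrib_left sum_subtractf algebra_simps power2_eq_square)
    then have "\<epsilon> * (x k * P - T) + (1 - \<epsilon>) * ((x k * x k - 1) * x k) = 0"
      using grad[OF that] unfolding sum_coupling[OF fin that] by simp
    then show ?thesis
      by (simp add: algebra_simps power3_eq_cube)
  qed
  have "(\<Sum>k\<in>S. \<Sum>j\<in>S. coupling \<epsilon> k j * (x j)\<^sup>2) = (\<Sum>k\<in>S. \<epsilon> * P + (1 - \<epsilon>) * (x k)\<^sup>2)"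
    by (intro sum.cong refl) (simp add: sum_coupling[OF fin] P_def)
  also have "\<dots> = \<epsilon> * m * P + (1 - \<epsilon>) * P"
    by (simp add: sum.distrib sum_distrib_left[symmetric] m_def P_def)
  finally have s1: "(\<Sum>k\<in>S. \<Sum>j\<in>S. coupling \<epsilon> k j * (x j)\<^sup>2) = \<epsilon> * m * P + (1 - \<epsilon>) * P" .
  have "(\<Sum>k\<in>S. \<Sum>j\<in>S. coupling \<epsilon> k j * (2 * x k * x j - 1))
      = (\<Sum>k\<in>S. \<epsilon> * (2 * x k * T - m) + (1 - \<epsilon>) * (2 * (x k)\<^sup>2 - 1))"
  proof (intro sum.cong refl)
    fix k assume "k \<in> S"
    have "(\<Sum>j\<in>S. 2 * x k * x j - 1) = 2 * x k * T - m"
      by (simp add: T_def m_def sum_distrib_left sum_subtractf)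
    then show "(\<Sum>j\<in>S. coupling \<epsilon> k j * (2 * x k * x j - 1))
        = \<epsilon> * (2 * x k * T - m) + (1 - \<epsilon>) * (2 * (x k)\<^sup>2 - 1)"
      by (simp add: sum_coupling[OF fin \<open>k \<in> S\<close>] power2_eq_square)
  qed
  also have "\<dots> = \<epsilon> * (2 * T * T - m * m) + (1 - \<epsilon>) * (2 * P - m)"
    by (simp add: sum.distrib sum_subtractf sum_distrib_left[symmetric] sum_distrib_right[symmetric]
        m_def P_def flip: T_def)
  finally have s2: "(\<Sum>k\<in>S. \<Sum>j\<in>S. coupling \<epsilon> k j * (2 * x k * x j - 1))
      = \<epsilon> * (2 * T * T - m * m) + (1 - \<epsilon>) * (2 * P - m)" .
  \<comment> \<open>Cauchy-Schwarz. Replacing \<open>T * T\<close> by \<open>P * m\<close> in the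
    curvature inequality makes its right-hand side factor, and the second factor is
    positive.\<close>
  have "T\<^sup>2 \<le> P * m"
    unfolding T_def P_def m_def using sum_squared_le_sum_of_squares[of x S] by (simp add: mult.commute)
  then have "\<epsilon> * (T * T) \<le> \<epsilon> * (P * m)"
    using epos by (intro mult_left_mono) (auto simp: power2_eq_square)
  then have "0 \<le> (3 * P - m) * (\<epsilon> * m + (1 - \<epsilon>))"
    using curv unfolding s1 s2 by (simp add: algebra_simps)
  moreover have "\<epsilon> * m + (1 - \<epsilon>) > 0"
    using epos mpos eps by (simp add: add_pos_nonneg)
  ultimately have P: "3 * P \<ge> m"
    by (simp add: zero_le_mult_iff)
  \<comment> \<open>This fixes the constant 3: \<open>3 * P \<ge> m\<close> and
    \<open>\<epsilon> * m \<ge> 3\<close> give \<open>\<epsilon> * P \<ge> 1\<close>, so the linear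
    coefficient of the cubic is positive.\<close>
  have c: "\<epsilon> * P - (1 - \<epsilon>) > 0"
  proof -
    have "\<epsilon> * (3 * P) \<ge> \<epsilon> * m"
      using P epos by (intro mult_left_mono) auto
    then have "\<epsilon> * P \<ge> 1"
      using large by (simp add: m_def)
    then show ?thesis using epos by linarith
  qed
  \<comment> \<open>Subtracting the two cubic equations leaves \<open>x k - x l\<close> times a
    positive factor.\<close>
  have const: "x k = x l" if "k \<in> S" "l \<in> S" for k l
  proof -
    have "(x k - x l) * ((1 - \<epsilon>) * ((x k)\<^sup>2 + x k * x l + (x l)\<^sup>2) + (\<epsilon> * P - (1 - \<epsilon>))) = 0"
      using cubic[OF that(1)] cubic[OF that(2)]
      by (simp add: algebra_simps power2_eq_square power3_eq_cube)
    moreover have "(x k)\<^sup>2 + x k * x l + (x l)\<^sup>2 \<ge> 0"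
    proof -
      have eq: "(x k)\<^sup>2 + x k * x l + (x l)\<^sup>2 = ((x k + x l)\<^sup>2 + (x k)\<^sup>2 + (x l)\<^sup>2) / 2"
        by (simp add: field_simps power2_eq_square)
      show ?thesis unfolding eq by simp
    qed
    then have "(1 - \<epsilon>) * ((x k)\<^sup>2 + x k * x l + (x l)\<^sup>2) + (\<epsilon> * P - (1 - \<epsilon>)) > 0"
      using eps c by (intro add_nonneg_pos) auto
    ultimately show ?thesis by simp
  qed
  obtain k where k: "k \<in> S"
    using mpos by (auto simp: m_def card_gt_0_iff)
  define y where "y = x k"
  have xy: "x j = y" if "j \<in> S" for j
    using const[OF that k] by (simp add: y_def)
  have Py: "P = m * y\<^sup>2" "T = m * y"
    unfolding P_def T_def by (simp_all add: xy m_def)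
  \<comment> \<open>For a constant vector of value \<open>y\<close> the cubic factors completely;
    the root 0 is excluded by \<open>3 * P \<ge> m\<close>.\<close>
  have "y * ((y\<^sup>2 - 1) * (\<epsilon> * m + (1 - \<epsilon>))) = 0"
    using cubic[OF k] unfolding Py y_def[symmetric]
    by (simp add: algebra_simps power2_eq_square power3_eq_cube)
  moreover have "y \<noteq> 0"
    using P mpos Py by auto
  ultimately have "y\<^sup>2 = 1"
    using \<open>\<epsilon> * m + (1 - \<epsilon>) > 0\<close> by simp
  then show ?thesis
    using xy by (auto simp: power2_eq_1_iff)
qed

section \<open>Minimizing the restricted objective over a box of fixed signs\<close>

lemma double_sum_remove:
  fixes f :: "nat \<Rightarrow> nat \<Rightarrow> real"
  assumes "finite S" "k \<in> S"
  shows "(\<Sum>i\<in>S. \<Sum>j\<in>S. f i j) = f k k + (\<Sum>j\<in>S - {k}. f k j + f j k)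
    + (\<Sum>i\<in>S - {k}. \<Sum>j\<in>S - {k}. f i j)"
  using assms by (simp add: sum.remove[of S k] sum.distrib)

text \<open>The objective of a point supported on \<open>S\<close>, in the coordinates
  \<open>x = m u\<close> and cleared of its denominator; every target entry becomes 1.\<close>

definition restricted_obj :: "real \<Rightarrow> nat set \<Rightarrow> (nat \<Rightarrow> real) \<Rightarrow> real" where
  "restricted_obj \<epsilon> S x = (\<Sum>i\<in>S. \<Sum>j\<in>S. coupling \<epsilon> i j * (x i * x j - 1)\<^sup>2)"

lemma continuous_restricted_obj: "continuous_on A (restricted_obj \<epsilon> S)"
proof -
  have "continuous_on A (\<lambda>x :: nat \<Rightarrow> real. x i)" for i
    using continuous_on_product_coordinates by (rule continuous_on_subset) simp
  then show ?thesis
    unfolding restricted_obj_def by (intro continuous_intros)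
qed

text \<open>Isolates one coordinate: a double well with minima at 1 and -1, a perturbation of order
  \<epsilon>, and a remainder free of \<open>t\<close>. Two values of the same coordinate can then
  be compared.\<close>

lemma restricted_obj_fun_upd:
  assumes fin: "finite S" and k: "k \<in> S"
  shows "restricted_obj \<epsilon> S (x(k := t)) = (t\<^sup>2 - 1)\<^sup>2 + 2 * \<epsilon> * (\<Sum>j\<in>S - {k}. (t * x j - 1)\<^sup>2)
    + restricted_obj \<epsilon> (S - {k}) x"
proof -
  have "(\<Sum>j\<in>S - {k}. coupling \<epsilon> k j * (t * x j - 1)\<^sup>2 + coupling \<epsilon> j k * (x j * t - 1)\<^sup>2)
      = 2 * \<epsilon> * (\<Sum>j\<in>S - {k}. (t * x j - 1)\<^sup>2)"
    by (auto simp: coupling_def sum_distrib_left mult.commute intro!: sum.cong)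
  then show ?thesis
    unfolding restricted_obj_def double_sum_remove[OF assms]
    by (simp add: coupling_def power2_eq_square)
qed

text \<open>For signs \<open>\<sigma> i\<close> in {-1, 1} this is the closed box of radius 1/2
  around the sign vector. Coordinates off \<open>S\<close> are pinned to 0, so that the box is
  compact among all functions on \<open>nat\<close>.\<close>

definition sign_box :: "nat set \<Rightarrow> (nat \<Rightarrow> real) \<Rightarrow> (nat \<Rightarrow> real) set" where
  "sign_box S \<sigma> = {x. \<forall>i. if i \<in> S then \<sigma> i * x i \<in> {1/2..3/2} else x i = 0}"

text \<open>Tychonoff: the box is a product of possibly reflected intervals and singletons.\<close>

lemma compact_sign_box:
  assumes "\<And>i. i \<in> S \<Longrightarrow> \<sigma> i \<in> {-1, 1}"
  shows "compact (sign_box S \<sigma>)"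
proof -
  define B where "B = (\<lambda>i. if i \<in> S then (\<lambda>t. \<sigma> i * t) ` {1/2..3/2} else {0})"
  have B: "(x \<in> B i) = (if i \<in> S then \<sigma> i * x \<in> {1/2..3/2} else x = 0)" for i x
  proof (cases "i \<in> S")
    case True
    then have "\<sigma> i = 1 \<or> \<sigma> i = -1" using assms by auto
    then have inv: "\<sigma> i * (\<sigma> i * y) = y" for y by auto
    have "x \<in> (\<lambda>t. \<sigma> i * t) ` I \<longleftrightarrow> \<sigma> i * x \<in> I" for I
    proof
      assume "\<sigma> i * x \<in> I"
      then show "x \<in> (\<lambda>t. \<sigma> i * t) ` I"
        by (rule rev_image_eqI) (simp only: inv)
    qed (auto simp only: inv)
    then show ?thesis
      using True by (simp only: B_def if_True)
  qed (simp add: B_def)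
  have "compact (B i)" for i
    unfolding B_def by (auto intro!: compact_continuous_image continuous_intros)
  then have "compactin (product_topology (\<lambda>i. euclidean) UNIV) (PiE UNIV B)"
    by (simp add: compactin_PiE)
  then have "compact (PiE UNIV B)"
    by (simp add: euclidean_product_topology)
  also have "PiE UNIV B = sign_box S \<sigma>"
    unfolding sign_box_def by (auto simp: PiE_def Pi_def B)
  finally show ?thesis .
qed

text \<open>Resetting a coordinate on the boundary of the box to its sign strictly lowers the objective,
  so the minimum over the box is attained in the interior.\<close>

lemma interior_minimizer:
  assumes fin: "finite S" and eps: "0 \<le> \<epsilon>" "25 * (\<epsilon> * real (card S)) \<le> 1"
    and sg: "\<And>i. i \<in> S \<Longrightarrow> \<sigma> i \<in> {-1, 1}"
  obtains x where "\<And>i. i \<in> S \<Longrightarrow> \<sigma> i * x i \<in> {1/2<..<3/2}"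
    and "\<And>i. i \<notin> S \<Longrightarrow> x i = 0"
    and "\<And>y. y \<in> sign_box S \<sigma> \<Longrightarrow> restricted_obj \<epsilon> S x \<le> restricted_obj \<epsilon> S y"
proof -
  have sg2: "\<sigma> i * \<sigma> i = 1" if "i \<in> S" for i using sg[OF that] by auto
  have "(\<lambda>i. if i \<in> S then \<sigma> i else 0) \<in> sign_box S \<sigma>"
    by (auto simp: sign_box_def sg2)
  then have "sign_box S \<sigma> \<noteq> {}" by blast
  from continuous_attains_inf[OF compact_sign_box this continuous_restricted_obj] sg
  have "\<exists>x\<in>sign_box S \<sigma>. \<forall>y\<in>sign_box S \<sigma>. restricted_obj \<epsilon> S x \<le> restricted_obj \<epsilon> S y"
    by simp
  then obtain x where x: "x \<in> sign_box S \<sigma>"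
    and min: "\<And>y. y \<in> sign_box S \<sigma> \<Longrightarrow> restricted_obj \<epsilon> S x \<le> restricted_obj \<epsilon> S y"
    by (elim bexE) simp
  have box: "\<sigma> i * x i \<in> {1/2..3/2}" if "i \<in> S" for i
    using x that by (auto simp: sign_box_def dest!: spec[of _ i])
  have x0: "x i = 0" if "i \<notin> S" for i
    using x that by (auto simp: sign_box_def dest!: spec[of _ i])
  have "\<sigma> k * x k \<in> {1/2<..<3/2}" if k: "k \<in> S" for k
  proof (rule ccontr)
    assume "\<sigma> k * x k \<notin> {1/2<..<3/2}"
    moreover have "\<sigma> k * x k \<in> {1/2..3/2}"
      by (rule box[OF k])
    ultimately have "\<sigma> k * x k = 1/2 \<or> \<sigma> k * x k = 3/2" by auto
    moreover have "\<sigma> k = 1 \<or> \<sigma> k = -1" using sg[OF k] by auto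
    ultimately have "x k = 1/2 \<or> x k = 3/2 \<or> x k = -1/2 \<or> x k = -3/2"
      by (elim disjE) auto
    \<comment> \<open>At distance 1/2 from the well the value is \<open>(1/4 - 1)^2 = 9/16\<close>
      on the inner side and \<open>(9/4 - 1)^2 = 25/16\<close> on the outer side.\<close>
    then have far: "((x k)\<^sup>2 - 1)\<^sup>2 \<ge> 9/16"
      by (elim disjE; simp only:; simp add: power2_eq_square)
    \<comment> \<open>After the reset the double well contributes 0, and each coupled square is at
      most \<open>(5/2)^2\<close>. The part depending on coordinate \<open>k\<close> is thus at most
      \<open>25/2 * \<epsilon> * card S\<close>, hence at most 1/2 and below 9/16: the origin of the
      constant 25.\<close>
    have "(\<Sum>j\<in>S - {k}. (\<sigma> k * x j - 1)\<^sup>2) \<le> (\<Sum>j\<in>S - {k}. 25/4)"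
    proof (rule sum_mono)
      fix j assume j: "j \<in> S - {k}"
      then have "\<sigma> j * x j \<in> {1/2..3/2}"
        using box by blast
      then have "\<bar>x j\<bar> \<le> 3/2"
        using sg[of j] j by auto
      moreover have "\<sigma> k * x j = x j \<or> \<sigma> k * x j = - x j"
        using sg[OF k] by auto
      ultimately have "\<bar>\<sigma> k * x j - 1\<bar> \<le> 5/2"
        by linarith
      then have "(\<sigma> k * x j - 1)\<^sup>2 \<le> (5/2)\<^sup>2"
        by (intro abs_le_square_iff[THEN iffD1]) simp
      then show "(\<sigma> k * x j - 1)\<^sup>2 \<le> 25/4" by (simp add: power2_eq_square)
    qed
    also have "\<dots> \<le> real (card S) * (25/4)"
      using fin card_mono[of S "S - {k}"] by auto
    finally have "2 * \<epsilon> * (\<Sum>j\<in>S - {k}. (\<sigma> k * x j - 1)\<^sup>2) \<le> 2 * \<epsilon> * (real (card S) * (25/4))"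
      using eps by (intro mult_left_mono) auto
    also have "\<dots> \<le> 1/2" using eps by simp
    finally have "restricted_obj \<epsilon> S (x(k := \<sigma> k)) \<le> 1/2 + restricted_obj \<epsilon> (S - {k}) x"
      using sg[OF k] unfolding restricted_obj_fun_upd[OF fin k] by auto
    moreover have "2 * \<epsilon> * (\<Sum>j\<in>S - {k}. (x k * x j - 1)\<^sup>2) \<ge> 0"
      using eps by (intro mult_nonneg_nonneg sum_nonneg) auto
    \<comment> \<open>The trivial update \<open>x(k := x k)\<close> brings \<open>x\<close> itself
      into the form of \<open>restricted_obj_fun_upd\<close>, with the same remainder as the reset
      point.\<close>
    then have "restricted_obj \<epsilon> S (x(k := x k)) \<ge> 9/16 + restricted_obj \<epsilon> (S - {k}) x"
      unfolding restricted_obj_fun_upd[OF fin k] using far by linarith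
    moreover have "x(k := \<sigma> k) \<in> sign_box S \<sigma>"
      using k by (simp add: sign_box_def sg2 x0 box del: atLeastAtMost_iff) simp
    ultimately show False
      using min[of "x(k := \<sigma> k)"] by simp
  qed
  then show thesis using min that x0 by blast
qed

section \<open>The instance attached to a graph\<close>

text \<open>Nonemptiness of \<open>S\<close> yields \<open>n > 0\<close>, \<open>m \<ge> 1\<close>
  and \<open>Z > 0\<close>, on which the rescaling depends.\<close>

locale graph_instance =
  fixes n :: nat and E :: "nat set set" and S :: "nat set" and \<epsilon> :: real
  assumes S: "S \<subseteq> {..<n}" and S_ne: "S \<noteq> {}" and eps: "0 \<le> \<epsilon>" "\<epsilon> \<le> 1"
begin

definition m :: real where "m = real (card S)"
abbreviation "Z \<equiv> Z_eps n E S \<epsilon>"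
abbreviation "C \<equiv> C_eps n E S \<epsilon>"
abbreviation "us \<equiv> u_star n S"

lemma finite_S: "finite S"
  using S finite_subset by blast

lemma m_ge_1: "m \<ge> 1"
  using S_ne finite_S by (simp add: m_def Suc_le_eq card_gt_0_iff)

lemma Z_pos: "Z > 0"
proof -
  have "n > 0" using S S_ne by auto
  moreover have "m * (m - 1) * \<epsilon> \<ge> 0" using m_ge_1 eps by simp
  ultimately show ?thesis by (simp add: Z_eps_def m_def)
qed

lemma C_sym: "\<forall>i<n. \<forall>j<n. C $$ (i, j) = C $$ (j, i)"
  by (auto simp: C_eps_def insert_commute)

lemma C_nonneg: "i < n \<Longrightarrow> j < n \<Longrightarrow> 0 \<le> C $$ (i, j)"
  using Z_pos eps by (simp add: C_eps_def)

lemma C_diag: "i < n \<Longrightarrow> C $$ (i, i) = 1 / Z"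
  by (simp add: C_eps_def)

lemma C_S: "i \<in> S \<Longrightarrow> j \<in> S \<Longrightarrow> C $$ (i, j) = coupling \<epsilon> i j / Z"
  using S by (auto simp: C_eps_def coupling_def subset_iff)

lemma dim_us [simp]: "dim_vec us = n"
  by (simp add: u_star_def)

lemma us_index: "i < n \<Longrightarrow> us $ i = (if i \<in> S then 1 / m else 0)"
  by (simp add: u_star_def m_def)

section \<open>Reduction of the objective to the independent set\<close>

lemma sum_to_S: "(\<And>i. i < n \<Longrightarrow> i \<notin> S \<Longrightarrow> f i = 0) \<Longrightarrow> (\<Sum>i<n. f i) = (\<Sum>i\<in>S. f i)"
  for f :: "nat \<Rightarrow> real"
  using S by (intro sum.mono_neutral_right) auto

text \<open>On \<open>S\<close> the target product is \<open>1 / m^2\<close>, so each residual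
  scales by \<open>1 / m^2\<close> and each squared residual by \<open>1 / m^4\<close>;
  \<open>Z\<close> comes from the weights.\<close>

lemma mc_obj_on_S:
  assumes "\<And>i. i < n \<Longrightarrow> i \<notin> S \<Longrightarrow> u $ i = 0"
  shows "mc_obj C us u = restricted_obj \<epsilon> S (\<lambda>i. m * u $ i) / (Z * m ^ 4)"
proof -
  have "mc_obj C us u = (\<Sum>i\<in>S. \<Sum>j<n. C $$ (i, j) * (u $ i * u $ j - us $ i * us $ j)\<^sup>2)"
    unfolding mc_obj_def dim_us by (rule sum_to_S) (simp add: us_index assms)
  also have "\<dots> = (\<Sum>i\<in>S. \<Sum>j\<in>S. C $$ (i, j) * (u $ i * u $ j - us $ i * us $ j)\<^sup>2)"
    by (intro sum.cong refl sum_to_S) (simp add: us_index assms)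
  also have "\<dots> = (\<Sum>i\<in>S. \<Sum>j\<in>S. coupling \<epsilon> i j * (m * u $ i * (m * u $ j) - 1)\<^sup>2 / (Z * m ^ 4))"
  proof (intro sum.cong refl)
    fix i j assume ij: "i \<in> S" "j \<in> S"
    then have "i < n" "j < n" using S by auto
    then have us: "us $ i * us $ j = 1 / m\<^sup>2"
      using ij by (simp add: us_index power2_eq_square)
    have "u $ i * u $ j - 1 / m\<^sup>2 = (m * u $ i * (m * u $ j) - 1) / m\<^sup>2"
      using m_ge_1 by (simp add: field_simps power2_eq_square)
    then show "C $$ (i, j) * (u $ i * u $ j - us $ i * us $ j)\<^sup>2
       = coupling \<epsilon> i j * (m * u $ i * (m * u $ j) - 1)\<^sup>2 / (Z * m ^ 4)"
      unfolding us C_S[OF ij] by (simp add: power_divide)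
  qed
  finally show ?thesis
    by (simp add: restricted_obj_def sum_divide_distrib)
qed

text \<open>Zeroing the coordinates off \<open>S\<close> never raises the objective: every affected
  residual has target 0 and becomes 0, and the weights are nonnegative.\<close>

lemma mc_obj_ge_restricted:
  "mc_obj C us v \<ge> restricted_obj \<epsilon> S (\<lambda>i. m * v $ i) / (Z * m ^ 4)"
proof -
  define w where "w = Matrix.vec n (\<lambda>i. if i \<in> S then v $ i else 0)"
  have "restricted_obj \<epsilon> S (\<lambda>i. m * v $ i) = restricted_obj \<epsilon> S (\<lambda>i. m * w $ i)"
    unfolding restricted_obj_def w_def using S by (auto intro!: sum.cong simp: subset_iff)
  also have "\<dots> / (Z * m ^ 4) = mc_obj C us w"
    by (rule mc_obj_on_S[symmetric]) (simp add: w_def)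
  also have "\<dots> \<le> mc_obj C us v"
    unfolding mc_obj_def dim_us
    by (intro sum_mono mult_left_mono C_nonneg) (auto simp: w_def us_index)
  finally show ?thesis .
qed

section \<open>Second-order critical points under strong coupling\<close>

lemma critical_eq_0:
  assumes u: "u \<in> carrier_vec n" and grad: "gradient (mc_obj C us) u = 0\<^sub>v n"
    and k: "k < n" "k \<notin> S"
  shows "u $ k = 0"
proof -
  have "partial k (mc_obj C us) u = 0"
    using arg_cong[OF grad, of "\<lambda>v. v $ k"] u k by (simp add: gradient_def)
  then have "(\<Sum>j<n. C $$ (k, j) * (u $ k * u $ j - us $ k * us $ j) * u $ j) = 0"
    using partial_mc_obj[OF u dim_us k(1) C_sym] by simp
  also have "(\<Sum>j<n. C $$ (k, j) * (u $ k * u $ j - us $ k * us $ j) * u $ j)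
      = u $ k * (\<Sum>j<n. C $$ (k, j) * (u $ j)\<^sup>2)"
    using k by (simp add: us_index sum_distrib_left power2_eq_square algebra_simps)
  finally have "u $ k = 0 \<or> (\<Sum>j<n. C $$ (k, j) * (u $ j)\<^sup>2) = 0" by simp
  \<comment> \<open>The diagonal term, with positive weight \<open>1 / Z\<close>, bounds the sum
    from below, so the sum too can vanish only when \<open>u $ k = 0\<close>.\<close>
  moreover have "(\<Sum>j<n. C $$ (k, j) * (u $ j)\<^sup>2) \<ge> C $$ (k, k) * (u $ k)\<^sup>2"
    using k C_nonneg by (intro member_le_sum) auto
  moreover have "C $$ (k, k) > 0"
    using C_diag k Z_pos by simp
  ultimately show ?thesis
    by (smt (verit) mult_pos_pos zero_less_power2)
qed

text \<open>Since \<open>u\<close> vanishes off \<open>S\<close>, both optimality conditions become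
  conditions on \<open>x = m u\<close> over \<open>S\<close>, up to positive factors, and
  \<open>critical_on_independent_set\<close> applies.\<close>

lemma second_order_critical_eq:
  assumes crit: "second_order_critical n (mc_obj C us) u" and large: "3 \<le> \<epsilon> * m"
  shows "outer u = outer us"
proof -
  have u: "u \<in> carrier_vec n" and grad: "gradient (mc_obj C us) u = 0\<^sub>v n"
    and hess: "pos_semidef (hessian (mc_obj C us) u)"
    using crit by (auto simp: second_order_critical_def)
  note u0 = critical_eq_0[OF u grad]
  define x where "x = (\<lambda>i. m * u $ i)"
  have m0: "m \<noteq> 0" and Z0: "Z \<noteq> 0" using m_ge_1 Z_pos by auto
  have ux: "u $ i = x i / m" for i using m0 by (simp add: x_def)
  have x0: "x i = 0" if "i < n" "i \<notin> S" for i
    using u0[OF that] by (simp add: x_def)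
  have "(\<Sum>j\<in>S. coupling \<epsilon> k j * ((x k * x j - 1) * x j)) = 0" if k: "k \<in> S" for k
  proof -
    have kn: "k < n" using S k by auto
    have "partial k (mc_obj C us) u = 0"
      using arg_cong[OF grad, of "\<lambda>v. v $ k"] u kn by (simp add: gradient_def)
    then have "0 = (\<Sum>j<n. C $$ (k, j) * (u $ k * u $ j - us $ k * us $ j) * u $ j)"
      using partial_mc_obj[OF u dim_us kn C_sym] by simp
    also have "\<dots> = (\<Sum>j\<in>S. C $$ (k, j) * (u $ k * u $ j - us $ k * us $ j) * u $ j)"
      by (rule sum_to_S) (simp add: u0)
    \<comment> \<open>The weight gives \<open>1 / Z\<close>, the residual \<open>1 / m^2\<close> and
      the last factor \<open>1 / m\<close>.\<close>
    also have "\<dots> = (\<Sum>j\<in>S. coupling \<epsilon> k j * ((x k * x j - 1) * x j) / (Z * m ^ 3))"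
      using k kn S m0 Z0
      by (intro sum.cong refl) (auto simp: ux C_S us_index field_simps power3_eq_cube subset_iff)
    also have "\<dots> = (\<Sum>j\<in>S. coupling \<epsilon> k j * ((x k * x j - 1) * x j)) / (Z * m ^ 3)"
      by (simp add: sum_divide_distrib)
    finally show ?thesis using m0 Z0 by simp
  qed
  moreover have "0 \<le> (\<Sum>k\<in>S. \<Sum>j\<in>S. coupling \<epsilon> k j * (x j)\<^sup>2)
       + (\<Sum>k\<in>S. \<Sum>j\<in>S. coupling \<epsilon> k j * (2 * x k * x j - 1))"
  proof -
    define H where "H = hessian (mc_obj C us) u"
    \<comment> \<open>The indicator of \<open>S\<close>, that is, the all-ones direction in the
      reduced problem; its quadratic form is the sum of all Hessian entries over
      \<open>S\<close>.\<close>
    define v where "v = Matrix.vec n (\<lambda>i. of_bool (i \<in> S) :: real)"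
    have H: "H \<in> carrier_mat n n" using u by (simp add: H_def hessian_def)
    have v: "v \<in> carrier_vec n" by (simp add: v_def)
    have "0 \<le> v \<bullet> (H *\<^sub>v v)"
      using hess v H unfolding pos_semidef_def H_def[symmetric] by auto
    also have "\<dots> = (\<Sum>i<n. \<Sum>j<n. v $ i * H $$ (i, j) * v $ j)"
      by (rule scalar_prod_mult_mat_vec[OF H v])
    also have "\<dots> = (\<Sum>i\<in>S. \<Sum>j<n. v $ i * H $$ (i, j) * v $ j)"
      by (rule sum_to_S) (simp add: v_def)
    also have "\<dots> = (\<Sum>i\<in>S. \<Sum>j\<in>S. v $ i * H $$ (i, j) * v $ j)"
      by (intro sum.cong refl sum_to_S) (simp add: v_def)
    also have "\<dots> = (\<Sum>i\<in>S. \<Sum>j\<in>S. H $$ (i, j))"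
      using S by (intro sum.cong refl) (auto simp: v_def subset_iff)
    also have "\<dots> = (\<Sum>i\<in>S. \<Sum>j\<in>S. 4 / (Z * m\<^sup>2) * (of_bool (i = j) * (\<Sum>l\<in>S. coupling \<epsilon> j l * (x l)\<^sup>2)
        + coupling \<epsilon> j i * (2 * x j * x i - 1)))"
    proof (intro sum.cong refl)
      fix i j assume ij: "i \<in> S" "j \<in> S"
      then have ijn: "i < n" "j < n" using S by auto
      have "(\<Sum>l<n. C $$ (j, l) * (u $ l)\<^sup>2) = (\<Sum>l\<in>S. C $$ (j, l) * (u $ l)\<^sup>2)"
        by (rule sum_to_S) (simp add: u0)
      also have "\<dots> = (\<Sum>l\<in>S. coupling \<epsilon> j l * (x l)\<^sup>2) / (Z * m\<^sup>2)"
        unfolding sum_divide_distrib using ij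
        by (intro sum.cong refl) (simp add: ux C_S power_divide)
      finally have *: "(\<Sum>l<n. C $$ (j, l) * (u $ l)\<^sup>2) = (\<Sum>l\<in>S. coupling \<epsilon> j l * (x l)\<^sup>2) / (Z * m\<^sup>2)" .
      have **: "C $$ (j, i) * (2 * u $ j * u $ i - us $ j * us $ i)
          = coupling \<epsilon> j i * (2 * x j * x i - 1) / (Z * m\<^sup>2)"
        using ij ijn m0 Z0 by (simp add: C_S us_index ux field_simps power2_eq_square)
      have "H $$ (i, j) = partial i (partial j (mc_obj C us)) u"
        using u ijn by (simp add: H_def hessian_def)
      also have "\<dots> = 4 * (of_bool (i = j) * ((\<Sum>l\<in>S. coupling \<epsilon> j l * (x l)\<^sup>2) / (Z * m\<^sup>2))
          + coupling \<epsilon> j i * (2 * x j * x i - 1) / (Z * m\<^sup>2))"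
        unfolding partial_partial_mc_obj[OF u dim_us ijn(2) ijn(1) C_sym] * ** ..
      finally show "H $$ (i, j) = 4 / (Z * m\<^sup>2) * (of_bool (i = j) * (\<Sum>l\<in>S. coupling \<epsilon> j l * (x l)\<^sup>2)
        + coupling \<epsilon> j i * (2 * x j * x i - 1))"
        by (simp add: add_divide_distrib distrib_left)
    qed
    also have "\<dots> = 4 / (Z * m\<^sup>2) * ((\<Sum>i\<in>S. \<Sum>j\<in>S. of_bool (i = j) * (\<Sum>l\<in>S. coupling \<epsilon> j l * (x l)\<^sup>2))
        + (\<Sum>i\<in>S. \<Sum>j\<in>S. coupling \<epsilon> j i * (2 * x j * x i - 1)))"
      by (simp only: sum_distrib_left[symmetric] sum.distrib)
    also have "(\<Sum>i\<in>S. \<Sum>j\<in>S. of_bool (i = j) * (\<Sum>l\<in>S. coupling \<epsilon> j l * (x l)\<^sup>2))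
        = (\<Sum>i\<in>S. \<Sum>l\<in>S. coupling \<epsilon> i l * (x l)\<^sup>2)"
      using finite_S by (simp add: of_bool_def if_distrib[of "\<lambda>x. x * _"] cong: if_cong)
    also have "(\<Sum>i\<in>S. \<Sum>j\<in>S. coupling \<epsilon> j i * (2 * x j * x i - 1))
        = (\<Sum>k\<in>S. \<Sum>j\<in>S. coupling \<epsilon> k j * (2 * x k * x j - 1))"
      by (rule sum.swap)
    finally have "0 \<le> 4 / (Z * m\<^sup>2) * ((\<Sum>k\<in>S. \<Sum>j\<in>S. coupling \<epsilon> k j * (x j)\<^sup>2)
       + (\<Sum>k\<in>S. \<Sum>j\<in>S. coupling \<epsilon> k j * (2 * x k * x j - 1)))" .
    moreover have "0 < 4 / (Z * m\<^sup>2)"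
      using Z_pos m_ge_1 by simp
    ultimately show ?thesis
      by (meson mult_pos_neg not_le)
  qed
  ultimately have "(\<forall>k\<in>S. x k = 1) \<or> (\<forall>k\<in>S. x k = -1)"
    using critical_on_independent_set[OF finite_S eps] large unfolding m_def by blast
  \<comment> \<open>The common sign of \<open>x\<close> cancels in products, and products with an
    index off \<open>S\<close> vanish on both sides.\<close>
  then have "u $ i * u $ j = us $ i * us $ j" if "i < n" "j < n" for i j
    using that by (cases "i \<in> S"; cases "j \<in> S") (auto simp: us_index ux x0)
  then show ?thesis
    using u by (auto simp: outer_def intro!: eq_matI)
qed

lemma global_minimum_if_outer_eq:
  assumes u: "u \<in> carrier_vec n" and eq: "outer u = outer us"
  shows "global_minimum n (mc_obj C us) u"
proof -
  have "u $ i * u $ j = us $ i * us $ j" if "i < n" "j < n" for i j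
    using arg_cong[OF eq, of "\<lambda>A. A $$ (i, j)"] u that by (simp add: outer_def)
  then have "mc_obj C us u = 0"
    by (simp add: mc_obj_def)
  moreover have "mc_obj C us v \<ge> 0" for v
    unfolding mc_obj_def dim_us by (intro sum_nonneg mult_nonneg_nonneg C_nonneg) auto
  ultimately show ?thesis using u by (simp add: global_minimum_def)
qed

section \<open>Spurious local minima under weak coupling\<close>

text \<open>The interior minimizer of the sign box, scaled by \<open>1 / m\<close> and extended by
  0, is a local minimum in all coordinates: moving off \<open>S\<close> cannot help by
  \<open>mc_obj_ge_restricted\<close>, and small moves within \<open>S\<close> stay in the
  box.\<close>

lemma local_minimum_of_signs:
  assumes small: "25 * (\<epsilon> * m) \<le> 1" and sg: "\<And>i. i \<in> S \<Longrightarrow> \<sigma> i \<in> {-1, 1}"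
  shows "\<exists>u. local_minimum n (mc_obj C us) u \<and> (\<forall>i\<in>S. \<sigma> i * u $ i > 0)"
proof -
  obtain x where x: "\<And>i. i \<in> S \<Longrightarrow> \<sigma> i * x i \<in> {1/2<..<3/2}"
    and x0: "\<And>i. i \<notin> S \<Longrightarrow> x i = 0"
    and min: "\<And>y. y \<in> sign_box S \<sigma> \<Longrightarrow> restricted_obj \<epsilon> S x \<le> restricted_obj \<epsilon> S y"
    using interior_minimizer[where \<sigma> = \<sigma>, OF finite_S eps(1) small[unfolded m_def] sg] by blast
  have mpos: "m > 0" using m_ge_1 by simp
  define u where "u = Matrix.vec n (\<lambda>i. x i / m)"
  have u: "u \<in> carrier_vec n" by (simp add: u_def)
  have ui: "u $ i = x i / m" if "i < n" for i using that by (simp add: u_def)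
  have Sn: "i < n" if "i \<in> S" for i using S that by auto
  \<comment> \<open>\<open>\<rho> i\<close> is the distance of coordinate \<open>i\<close> to the
    ends of its interval; the least such distance is divided by \<open>m\<close> to return to the
    scale of \<open>u\<close>.\<close>
  define \<rho> where "\<rho> = (\<lambda>i. min (\<sigma> i * x i - 1/2) (3/2 - \<sigma> i * x i))"
  define \<delta> where "\<delta> = Min (\<rho> ` S) / m"
  have dpos: "\<delta> > 0"
    unfolding \<delta>_def using x S_ne finite_S mpos by (intro divide_pos_pos) (auto simp: \<rho>_def)
  have d: "m * \<delta> \<le> \<sigma> i * x i - 1/2" "m * \<delta> \<le> 3/2 - \<sigma> i * x i" if "i \<in> S" for i
  proof -
    have "m * \<delta> = Min (\<rho> ` S)"
      unfolding \<delta>_def using mpos by simp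
    also have "\<dots> \<le> \<rho> i"
      using finite_S that by simp
    finally show "m * \<delta> \<le> \<sigma> i * x i - 1/2" "m * \<delta> \<le> 3/2 - \<sigma> i * x i"
      by (auto simp: \<rho>_def)
  qed
  have "mc_obj C us u \<le> mc_obj C us v"
    if v: "v \<in> carrier_vec n" and close: "sqrt ((v - u) \<bullet> (v - u)) < \<delta>" for v
  proof -
    have near: "\<bar>v $ i - u $ i\<bar> < \<delta>" if i: "i < n" for i
    proof -
      have "(v - u) \<bullet> (v - u) = (\<Sum>j<n. (v $ j - u $ j)\<^sup>2)"
        using u v by (simp add: scalar_prod_def power2_eq_square lessThan_atLeast0)
      moreover have "(v $ i - u $ i)\<^sup>2 \<le> (\<Sum>j<n. (v $ j - u $ j)\<^sup>2)"
        using i by (intro member_le_sum) auto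
      ultimately have "\<bar>v $ i - u $ i\<bar> \<le> sqrt ((v - u) \<bullet> (v - u))"
        by (metis real_sqrt_abs real_sqrt_le_iff)
      then show ?thesis using close by simp
    qed
    \<comment> \<open>The projection of the nearby point to \<open>S\<close>, rescaled, to be
      compared with \<open>x\<close> inside the box.\<close>
    define y where "y = (\<lambda>i. if i \<in> S then m * v $ i else 0)"
    have "y \<in> sign_box S \<sigma>"
    proof -
      have "\<sigma> i * (m * v $ i) \<in> {1/2..3/2}" if i: "i \<in> S" for i
      proof -
        have "\<bar>m * v $ i - x i\<bar> = m * \<bar>v $ i - u $ i\<bar>"
        proof -
          have "m * v $ i - x i = m * (v $ i - u $ i)"
            using mpos ui[OF Sn[OF i]] by (simp add: right_diff_distrib)
          then show ?thesis
            using mpos by (simp add: abs_mult)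
        qed
        also have "\<dots> \<le> m * \<delta>"
          using near[OF Sn[OF i]] mpos by simp
        finally show ?thesis
          using d[OF i] sg[OF i] by auto
      qed
      then show ?thesis by (simp add: sign_box_def y_def)
    qed
    have xu: "restricted_obj \<epsilon> S (\<lambda>i. m * u $ i) = restricted_obj \<epsilon> S x"
      unfolding restricted_obj_def using mpos by (auto intro!: sum.cong simp: ui Sn)
    have yv: "restricted_obj \<epsilon> S (\<lambda>i. m * v $ i) = restricted_obj \<epsilon> S y"
      unfolding restricted_obj_def y_def by (auto intro!: sum.cong)
    have "mc_obj C us u = restricted_obj \<epsilon> S x / (Z * m ^ 4)"
      using mc_obj_on_S[of u] ui x0 xu by simp
    also have "\<dots> \<le> restricted_obj \<epsilon> S y / (Z * m ^ 4)"
      using min[OF \<open>y \<in> sign_box S \<sigma>\<close>] Z_pos mpos by (intro divide_right_mono) auto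
    also have "\<dots> \<le> mc_obj C us v"
      using mc_obj_ge_restricted[of v] yv by simp
    finally show ?thesis .
  qed
  then have "local_minimum n (mc_obj C us) u"
    using u dpos unfolding local_minimum_def by blast
  moreover have "\<sigma> i * u $ i > 0" if "i \<in> S" for i
    using x[OF that] mpos ui[OF Sn[OF that]] by (auto simp: zero_less_divide_iff)
  ultimately show ?thesis by blast
qed

text \<open>Each subset \<open>T\<close> of \<open>S\<close> prescribes the signs of a local
  minimum, positive exactly on \<open>T\<close>, and the signs recover \<open>T\<close>, so
  different subsets give different points.\<close>

lemma many_spurious_local_minima:
  assumes small: "25 * (\<epsilon> * m) \<le> 1"
  obtains A where "finite A" "\<And>u. u \<in> A \<Longrightarrow> spurious_local_minimum C us u"
    "card A = 2 ^ card S - 2"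
proof -
  define \<sigma> where "\<sigma> = (\<lambda>(T :: nat set) i. if i \<in> T then 1 else - 1 :: real)"
  have "\<exists>u. local_minimum n (mc_obj C us) u \<and> (\<forall>i\<in>S. \<sigma> T i * u $ i > 0)" for T
    by (rule local_minimum_of_signs[OF small]) (simp add: \<sigma>_def)
  then obtain U where U: "\<And>T. local_minimum n (mc_obj C us) (U T)"
    and sg: "\<And>T i. i \<in> S \<Longrightarrow> \<sigma> T i * U T $ i > 0"
    by metis
  have pos: "U T $ i > 0 \<longleftrightarrow> i \<in> T" "U T $ i < 0 \<longleftrightarrow> i \<notin> T" if "i \<in> S" for T i
    using sg[OF that, of T] by (auto simp: \<sigma>_def split: if_splits)
  \<comment> \<open>The two constant patterns are left out, since the ground truth and its negative
    have constant sign on \<open>S\<close>.\<close>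
  define D where "D = Pow S - {{}, S}"
  have "inj_on U D"
  proof (rule inj_onI)
    fix T T' assume "T \<in> D" "T' \<in> D" "U T = U T'"
    then show "T = T'" using pos(1)[of _ T] pos(1)[of _ T'] unfolding D_def by auto
  qed
  then have "card (U ` D) = card D" by (rule card_image)
  also have "card D = 2 ^ card S - 2"
    unfolding D_def using S_ne finite_S by (subst card_Diff_subset) (auto simp: card_Pow)
  finally have "card (U ` D) = 2 ^ card S - 2" .
  moreover have "spurious_local_minimum C us (U T)" if T: "T \<in> D" for T
  proof -
    \<comment> \<open>A mixed pattern has two entries of opposite sign, whose product is negative,
      while the ground truth product on \<open>S\<close> is positive.\<close>
    obtain i j where ij: "i \<in> T" "j \<in> S - T" "i \<in> S" using T unfolding D_def by blast
    then have n: "i < n" "j < n" using S by auto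
    have "U T $ i * U T $ j < 0"
      using ij pos[of i T] pos[of j T] by (auto simp: mult_pos_neg)
    moreover have "us $ i * us $ j > 0"
      using ij n m_ge_1 by (simp add: us_index)
    moreover have "dim_vec (U T) = n"
      using U[of T] by (simp add: local_minimum_def)
    ultimately have "outer (U T) $$ (i, j) \<noteq> outer us $$ (i, j)"
      using n by (simp add: outer_def)
    then show ?thesis using U[of T] by (auto simp: spurious_local_minimum_def)
  qed
  moreover have "finite (U ` D)" using finite_S by (simp add: D_def)
  ultimately show thesis using that by blast
qed

end

section \<open>Absolute constants and the final count\<close>

text \<open>Without self-loops a single vertex is independent, so an independent set of largest
  cardinality has at least one element.\<close>

lemma maximal_independent_set_nonempty:
  assumes "simple_graph n E" "maximal_independent_set n E S" "n > 0"
  shows "S \<noteq> {}"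
proof -
  have "independent_set n E {0}"
    using assms by (auto simp: independent_set_def simple_graph_def)
  then have "card {0 :: nat} \<le> card S"
    using assms unfolding maximal_independent_set_def by blast
  then show ?thesis by auto
qed

theorem theorem3p5:
  shows "\<exists>c1 c2 c3 :: real. c1 > 0 \<and> c2 > 0 \<and> c3 > 0 \<and>
    (\<forall>(n :: nat) (E :: nat set set) (S :: nat set) (\<epsilon> :: real).
       simple_graph n E \<longrightarrow> maximal_independent_set n E S \<longrightarrow> 0 \<le> \<epsilon> \<longrightarrow> \<epsilon> \<le> 1 \<longrightarrow>
         (\<epsilon> \<ge> c1 / real (card S) \<longrightarrow>
            (\<nexists>u. spurious_second_order_critical (C_eps n E S \<epsilon>) (u_star n S) u) \<and>
            (\<forall>u. second_order_critical n (mc_obj (C_eps n E S \<epsilon>) (u_star n S)) u \<longrightarrow>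
                 global_minimum n (mc_obj (C_eps n E S \<epsilon>) (u_star n S)) u \<and>
                 outer u = outer (u_star n S)))
       \<and> (\<epsilon> \<le> c2 / real (card S) \<longrightarrow> card S \<ge> 2 \<longrightarrow>
            (\<exists>A. finite A \<and>
                 (\<forall>u \<in> A. spurious_local_minimum (C_eps n E S \<epsilon>) (u_star n S) u) \<and>
                 real (card A) \<ge> c3 * 2 powr (real (card S) / 2))))"
\<comment> \<open>3 and 1/25 are the thresholds of \<open>critical_on_independent_set\<close> and
  \<open>interior_minimizer\<close>; the factor 1 suffices because \<open>2 ^ m - 2\<close> is at
  least \<open>2 powr (m / 2)\<close> for \<open>m \<ge> 2\<close>.\<close>
proof (rule exI[of _ 3], rule exI[of _ "1/25"], rule exI[of _ 1], intro conjI allI impI)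
  fix n :: nat and E S and \<epsilon> :: real
  assume graph: "simple_graph n E" and mis: "maximal_independent_set n E S"
    and eps: "0 \<le> \<epsilon>" "\<epsilon> \<le> 1"
  have Sn: "S \<subseteq> {..<n}"
    using mis by (simp add: maximal_independent_set_def independent_set_def)
  let ?g = "mc_obj (C_eps n E S \<epsilon>) (u_star n S)"
  {
    assume large: "3 / real (card S) \<le> \<epsilon>"
    have main: "global_minimum n ?g u \<and> outer u = outer (u_star n S)"
      if crit: "second_order_critical n ?g u" for u
    proof (cases "n = 0")
      \<comment> \<open>Here \<open>S\<close> is empty and \<open>3 / real (card S)\<close> is 0 by
        convention, so this case does arise; the empty vector is the only point.\<close>
      case True
      then show ?thesis
        using crit
        by (auto simp: second_order_critical_def global_minimum_def outer_def u_star_def mc_obj_def)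
    next
      case False
      interpret graph_instance n E S \<epsilon>
        using Sn eps maximal_independent_set_nonempty[OF graph mis] False by unfold_locales auto
      have "3 \<le> \<epsilon> * m"
        using large m_ge_1 by (simp add: m_def field_simps)
      then have "outer u = outer (u_star n S)"
        using second_order_critical_eq[OF crit] by simp
      then show ?thesis
        using global_minimum_if_outer_eq crit by (simp add: second_order_critical_def)
    qed
    then show "\<nexists>u. spurious_second_order_critical (C_eps n E S \<epsilon>) (u_star n S) u"
      by (auto simp: spurious_second_order_critical_def u_star_def)
    fix u assume "second_order_critical n ?g u"
    from main[OF this] show "global_minimum n ?g u" "outer u = outer (u_star n S)" by auto
  }
  \<comment> \<open>The count starts at two vertices: for a single one \<open>2 ^ card S - 2\<close>
    is 0.\<close>
  assume small: "\<epsilon> \<le> 1 / 25 / real (card S)" and card: "2 \<le> card S"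
  interpret graph_instance n E S \<epsilon>
    using Sn eps card by unfold_locales auto
  have "25 * (\<epsilon> * m) \<le> 1"
    using small m_ge_1 by (simp add: m_def field_simps)
  then obtain A where A: "finite A"
    "\<And>u. u \<in> A \<Longrightarrow> spurious_local_minimum (C_eps n E S \<epsilon>) (u_star n S) u"
    "card A = 2 ^ card S - 2"
    by (rule many_spurious_local_minima) blast
  have "1 * 2 powr (real (card S) / 2) \<le> real (card A)"
  proof -
    \<comment> \<open>The exponents compare because \<open>m / 2 \<le> m - 1\<close> exactly when
      \<open>m \<ge> 2\<close>.\<close>
    have "2 powr (real (card S) / 2) \<le> (2 :: real) powr (real (card S - 1))"
      using card by (intro powr_mono) auto
    also have "\<dots> = 2 ^ (card S - 1)"
      by (simp add: powr_realpow)
    also have "\<dots> \<le> 2 ^ card S - 2"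
    proof -
      obtain k where k: "card S = Suc (Suc k)" using card by (metis add_2_eq_Suc le_Suc_ex)
      then show ?thesis by simp
    qed
    also have "\<dots> = real (card A)"
    proof -
      \<comment> \<open>The cardinality is a truncated difference of naturals; this bound lets it
        pass to the reals.\<close>
      have "(2 :: nat) ^ 1 \<le> 2 ^ card S" using card by (intro power_increasing) auto
      then show ?thesis using A(3) by (simp add: of_nat_diff)
    qed
    finally show ?thesis by simp
  qed
  then show "\<exists>A. finite A \<and>
      (\<forall>u\<in>A. spurious_local_minimum (C_eps n E S \<epsilon>) (u_star n S) u) \<and>
      1 * 2 powr (real (card S) / 2) \<le> real (card A)"
    using A by blast
qed simp_all

end
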